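(* Let $m,q,r \in \mathbb{N}$ with $q\le m$. Then $\varepsilon(m,q)\ge 0$ and $$\binom{2^r m}{2^r q} \equiv 0 \pmod{2^{\varepsilon(m,q)}}, \qquad \binom{2^r m}{2^r q} \equiv \binom mq \pmod{2^{\varepsilon(m,q)+1}},$$ $$\binom{2^r m}{2^r q+1} \equiv \binom mq \pmod{2^{\varepsilon(m,q)}}, \qquad \binom{2^r m}{2^r q+1} \equiv 0 \pmod{2^{\varepsilon(m,q)+r}}.$$ In particular, $\binom{2^r m}{2^r q} \equiv \binom{2^r m}{2^r q+1} \pmod{2^{\varepsilon(m,q)}}$.
   Context: $\mathbb{N}=\{1,2,\dots\}$. For $k\in\mathbb{N}_0$, $\varepsilon(k)=\nu_2(k!)$ is the $2$-adic valuation of $k!$, i.e. $k!=2^{\varepsilon(k)}\ell_k$ with $\ell_k$ odd. For integers $0\le q\le m$, $\varepsilon(m,q) := \varepsilon(m)-\varepsilon(q)-\varepsilon(m-q)$. As usual $\binom{n}{k}=0$ for integers $k>n\ge 0$. *)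

theory Defs
  imports "HOL-Number_Theory.Cong" "HOL-Computational_Algebra.Primes"
begin

definition eps :: "nat \<Rightarrow> nat" where
  "eps k = multiplicity 2 (fact k :: nat)"

text \<open>Integer-valued, so that nonnegativity is a genuine claim; only meant for \<open>q \<le> m\<close>.\<close>

definition eps2 :: "nat \<Rightarrow> nat \<Rightarrow> int" where
  "eps2 m q = int (eps m) - int (eps q) - int (eps (m - q))"

end

theory Submission
  imports Defs
begin

text \<open>
  By Legendre's identity \<open>\<epsilon>(2n) = n + \<epsilon>(n)\<close>, the 2-adic valuation of
  \<open>m choose q\<close>, which is \<open>\<epsilon>(m, q)\<close>, does not change when both entries are doubled.
  Two numbers of the same valuation \<open>e\<close> agree modulo \<open>2^(e+1)\<close>, as their odd parts
  agree modulo 2. For the lower entry \<open>2^r q + 1\<close>, use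
  \<open>(k + 1) (n choose (k + 1)) = (n - k) (n choose k)\<close> with \<open>k + 1\<close> odd and
  \<open>2^r\<close> dividing \<open>n - k\<close>.
\<close>

lemma eps_Suc: "eps (Suc n) = multiplicity 2 (Suc n) + eps n"
  unfolding eps_def fact_Suc of_nat_id
  by (rule prime_elem_multiplicity_mult_distrib) auto

text \<open>Passing from n to n + 1 multiplies (2n)! by 2n + 1, which is odd, and by 2(n + 1), whose
  valuation exceeds that of n + 1 by exactly one.\<close>

lemma eps_double: "eps (2 * n) = n + eps n"
proof (induction n)
  case 0
  show ?case by simp
next
  case (Suc n)
  have "multiplicity 2 (2 * Suc n) = Suc (multiplicity 2 (Suc n))"
    by (rule multiplicity_times_same) auto
  moreover have "multiplicity 2 (Suc (2 * n)) = 0"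
    by (rule not_dvd_imp_multiplicity_0) simp
  ultimately have "eps (2 * Suc n) = Suc (multiplicity 2 (Suc n) + eps (2 * n))"
    using eps_Suc[of "Suc (2 * n)"] eps_Suc[of "2 * n"] by simp
  then show ?case
    using Suc eps_Suc[of n] by simp
qed

text \<open>Valuations are additive on q! (m - q)! (m choose q) = m!. The additive form avoids
  truncated subtraction on the naturals.\<close>

lemma eps_eq_multiplicity_binomial:
  assumes "q \<le> m"
  shows "eps m = eps q + eps (m - q) + multiplicity 2 (m choose q)"
proof -
  have "multiplicity 2 (fact q * fact (m - q) * (m choose q))
      = multiplicity 2 (fact q * fact (m - q) :: nat) + multiplicity 2 (m choose q)"
    using assms by (intro prime_elem_multiplicity_mult_distrib) auto
  also have "multiplicity 2 (fact q * fact (m - q) :: nat) = eps q + eps (m - q)"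
    unfolding eps_def by (rule prime_elem_multiplicity_mult_distrib) auto
  finally show ?thesis
    unfolding binomial_fact_lemma[OF assms] by (simp add: eps_def)
qed

lemma eps2_eq_multiplicity_binomial:
  assumes "q \<le> m"
  shows "eps2 m q = int (multiplicity 2 (m choose q))"
  using eps_eq_multiplicity_binomial[OF assms] by (simp add: eps2_def)

text \<open>Doubling adds m to the valuation of the numerator and q + (m - q) to that of the
  denominator, so the two cancel.\<close>

lemma multiplicity_binomial_double:
  assumes "q \<le> m"
  shows "multiplicity 2 ((2 * m) choose (2 * q)) = multiplicity 2 (m choose q)"
  using eps_eq_multiplicity_binomial[OF assms] eps_eq_multiplicity_binomial[of "2 * q" "2 * m"]
    assms eps_double[of m] eps_double[of q] eps_double[of "m - q"]
  by (simp add: diff_mult_distrib2)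

lemma multiplicity_binomial_power2:
  assumes "q \<le> m"
  shows "multiplicity 2 ((2 ^ r * m) choose (2 ^ r * q)) = multiplicity 2 (m choose q)"
proof (induction r)
  case (Suc r)
  then show ?case
    using multiplicity_binomial_double[of "2 ^ r * q" "2 ^ r * m"] assms
    by (simp add: mult.assoc)
qed simp

lemma cong_of_multiplicity_2_eq:
  fixes a b :: nat
  assumes "a \<noteq> 0" "b \<noteq> 0" "multiplicity 2 a = multiplicity 2 b"
  shows "[a = b] (mod 2 ^ Suc (multiplicity 2 b))"
proof -
  obtain c where c: "a = 2 ^ multiplicity 2 b * c" "odd c"
    using multiplicity_decompose'[of a 2] assms by auto
  obtain d where d: "b = 2 ^ multiplicity 2 b * d" "odd d"
    using multiplicity_decompose'[of b 2] assms by auto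
  have "[c = d] (mod 2)"
    using c(2) d(2) by (simp add: cong_def odd_iff_mod_2_eq_one)
  \<comment> \<open>Scaling a congruence by a power of 2 scales its modulus too; this gains the
    extra factor 2.\<close>
  then have "[2 ^ multiplicity 2 b * c = 2 ^ multiplicity 2 b * d] (mod 2 ^ multiplicity 2 b * 2)"
    by (simp add: cong_def mult_mod_right[symmetric])
  then show ?thesis
    using c(1) d(1) by (simp add: mult.commute)
qed

lemma power2_dvd_binomial_Suc:
  fixes m q r :: nat
  assumes "r \<ge> 1" "q \<le> m"
  shows "2 ^ (multiplicity 2 (m choose q) + r) dvd (2 ^ r * m) choose (2 ^ r * q + 1)"
proof -
  let ?e = "multiplicity 2 (m choose q)" and ?n = "2 ^ r * m" and ?k = "2 ^ r * q"
  have "2 ^ ?e dvd ?n choose ?k"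
    unfolding multiplicity_binomial_power2[OF assms(2), of r, symmetric]
    by (rule multiplicity_dvd)
  \<comment> \<open>The difference is 2^r (m - q). For q = m it is 0, and so is the target binomial,
    so this case needs no separate treatment.\<close>
  moreover have "2 ^ r dvd ?n - ?k"
    by simp
  ultimately have "2 ^ (?e + r) dvd (?n choose ?k) * (?n - ?k)"
    unfolding power_add by (rule mult_dvd_mono)
  \<comment> \<open>Both sides equal n ((n - 1) choose k).\<close>
  also have "\<dots> = (?n choose (?k + 1)) * (?k + 1)"
    using binomial_absorb_comp[of ?n ?k] binomial_absorption[of ?k ?n]
    by (simp add: mult.commute)
  finally have "2 ^ (?e + r) dvd (?n choose (?k + 1)) * (?k + 1)" .
  \<comment> \<open>Since r is at least 1, \<open>?k\<close> is even and \<open>?k + 1\<close> is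
    odd.\<close>
  moreover have "coprime (2 ^ (?e + r)) (?k + 1)"
    using assms(1) by simp
  ultimately show ?thesis
    by (simp only: coprime_dvd_mult_left_iff)
qed

theorem proposition4p11:
  fixes m q r :: nat
  assumes "m \<ge> 1" and "q \<ge> 1" and "r \<ge> 1" and "q \<le> m"
  shows "eps2 m q \<ge> 0
    \<and> [(2 ^ r * m) choose (2 ^ r * q) = 0] (mod 2 ^ nat (eps2 m q))
    \<and> [(2 ^ r * m) choose (2 ^ r * q) = m choose q] (mod 2 ^ nat (eps2 m q + 1))
    \<and> [(2 ^ r * m) choose (2 ^ r * q + 1) = m choose q] (mod 2 ^ nat (eps2 m q))
    \<and> [(2 ^ r * m) choose (2 ^ r * q + 1) = 0] (mod 2 ^ nat (eps2 m q + int r))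
    \<and> [(2 ^ r * m) choose (2 ^ r * q) = (2 ^ r * m) choose (2 ^ r * q + 1)]
        (mod 2 ^ nat (eps2 m q))"
proof -
  define e where "e = multiplicity 2 (m choose q)"
  let ?A = "(2 ^ r * m) choose (2 ^ r * q)" and ?B = "(2 ^ r * m) choose (2 ^ r * q + 1)"
  have eps2: "eps2 m q = int e" "nat (int e + 1) = Suc e" "nat (int e + int r) = e + r"
    using eps2_eq_multiplicity_binomial[OF assms(4)] by (simp_all add: e_def)
  have multA: "multiplicity 2 ?A = e"
    using multiplicity_binomial_power2[OF assms(4)] by (simp add: e_def)
  have A: "[?A = 0] (mod 2 ^ e)"
    using multiplicity_dvd[of 2 ?A] by (simp add: multA cong_0_iff)
  have C: "[m choose q = 0] (mod 2 ^ e)"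
    using multiplicity_dvd[of 2 "m choose q"] by (simp add: e_def cong_0_iff)
  have AC: "[?A = m choose q] (mod 2 ^ Suc e)"
    using cong_of_multiplicity_2_eq[of ?A "m choose q"] assms(4) multA by (simp add: e_def)
  have Br: "[?B = 0] (mod 2 ^ (e + r))"
    using power2_dvd_binomial_Suc[OF assms(3,4)] by (simp only: e_def cong_0_iff)
  then have B: "[?B = 0] (mod 2 ^ e)"
    by (rule cong_dvd_modulus_nat) (simp add: le_imp_power_dvd)
  show ?thesis
    \<comment> \<open>The congruences modulo \<open>2 ^ e\<close> that involve \<open>?B\<close>
      hold because all three binomials vanish modulo \<open>2 ^ e\<close>.\<close>
    unfolding eps2 nat_int
    using A AC Br cong_trans[OF B cong_sym[OF C]] cong_trans[OF A cong_sym[OF B]] by simp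
qed

end
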